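(* If $X$ is a $T_0$ topological space, then $\operatorname{o}(X)^{2^{\operatorname{sm}(X)}}\ge 2^{|X|}$.
   Context: Set membership game $G_\beta(Y,X)$ ($X$ a topological space, $Y\subseteq X$, $\beta$ an ordinal): two players, Seeker and Hider, make $\beta$ moves. At move $\alpha<\beta$, knowing all previous moves, the Seeker chooses an open set $U_\alpha\subseteq X$, and then the Hider chooses $V_\alpha\in\{U_\alpha, X\setminus U_\alpha\}$. The outcome is $W=\bigcap_{\alpha<\beta}V_\alpha$ (with $W=X$ if $\beta=0$). The Seeker wins iff $W\subseteq Y$ or $W\cap Y=\emptyset$. For a $T_0$ space $X$: $\operatorname{sm}(Y,X)$ is the least ordinal $\beta$ such that the Seeker has a winning strategy in $G_\beta(Y,X)$, and $\operatorname{sm}(X)=\sup\{\operatorname{sm}(Y,X):Y\subseteq X\}$ (an ordinal). $\operatorname{o}(X)$ is the number of open subsets of $X$. For an ordinal $\beta$, $2^\beta$ here denotes the cardinality of the set ${}^{\beta}2$ of functions from $\beta$ to $2$; all exponentiation is cardinal exponentiation. *)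

theory Defs
  imports "HOL-Analysis.Analysis"
begin

unbundle cardinal_syntax

text \<open>
  Ordinals are represented by well-orders \<open>r\<close>, considered up to \<open>=o\<close> and compared by
  \<open>\<le>o\<close>; the moves of the game of length \<open>r\<close> are indexed by \<open>Field r\<close>, and the moves
  preceding \<open>\<alpha>\<close> by \<open>underS r \<alpha>\<close>. The game of length 0 is the one with \<open>r = {}\<close>.

  A strategy of the Seeker maps a move index and the history of the game so far, which consists
  of the pairs (Seeker's set, Hider's set) at all earlier moves, to the next set of the Seeker.
\<close>

type_synonym ('i, 'a) seeker_strategy = "'i \<Rightarrow> ('i \<Rightarrow> 'a set \<times> 'a set) \<Rightarrow> 'a set"

definition history :: "'i rel \<Rightarrow> ('i \<Rightarrow> 'a set) \<Rightarrow> ('i \<Rightarrow> 'a set) \<Rightarrow> 'i \<Rightarrow> 'i \<Rightarrow> 'a set \<times> 'a set"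
  where "history r U V \<alpha> = restrict (\<lambda>\<gamma>. (U \<gamma>, V \<gamma>)) (underS r \<alpha>)"

definition legal_strategy :: "'a topology \<Rightarrow> 'i rel \<Rightarrow> ('i, 'a) seeker_strategy \<Rightarrow> bool"
  where "legal_strategy X r s \<longleftrightarrow> (\<forall>\<alpha>\<in>Field r. \<forall>h. openin X (s \<alpha> h))"

definition play_against ::
  "'a topology \<Rightarrow> 'i rel \<Rightarrow> ('i, 'a) seeker_strategy \<Rightarrow> ('i \<Rightarrow> 'a set) \<Rightarrow> ('i \<Rightarrow> 'a set) \<Rightarrow> bool"
  where "play_against X r s U V \<longleftrightarrow>
    (\<forall>\<alpha>\<in>Field r. U \<alpha> = s \<alpha> (history r U V \<alpha>) \<and> V \<alpha> \<in> {U \<alpha>, topspace X - U \<alpha>})"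

definition outcome :: "'a topology \<Rightarrow> 'i rel \<Rightarrow> ('i \<Rightarrow> 'a set) \<Rightarrow> 'a set"
  where "outcome X r V = topspace X \<inter> (\<Inter>\<alpha>\<in>Field r. V \<alpha>)"

definition winning_strategy ::
  "'a topology \<Rightarrow> 'a set \<Rightarrow> 'i rel \<Rightarrow> ('i, 'a) seeker_strategy \<Rightarrow> bool"
  where "winning_strategy X Y r s \<longleftrightarrow> legal_strategy X r s \<and>
    (\<forall>U V. play_against X r s U V \<longrightarrow> outcome X r V \<subseteq> Y \<or> outcome X r V \<inter> Y = {})"

definition seeker_wins :: "'a topology \<Rightarrow> 'a set \<Rightarrow> 'i rel \<Rightarrow> bool"
  where "seeker_wins X Y r \<longleftrightarrow> (\<exists>s. winning_strategy X Y r s)"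

text \<open>
  The ordinals below are chosen among the well-orders on \<open>'a set\<close>. For a \<open>T\<^sub>0\<close> space such
  ordinals exist, since the Seeker wins by playing all open sets, and they are least among the
  well-orders on arbitrary types: see \<open>sm_set_properties\<close>, \<open>sm_set_least\<close>,
  \<open>sm_space_properties\<close> and \<open>sm_space_least\<close>.
\<close>

definition sm_set :: "'a topology \<Rightarrow> 'a set \<Rightarrow> 'a set rel"
  where "sm_set X Y = (SOME r :: 'a set rel. Well_order r \<and> seeker_wins X Y r \<and>
    (\<forall>r' :: 'a set rel. Well_order r' \<and> seeker_wins X Y r' \<longrightarrow> r \<le>o r'))"

definition sm_space :: "'a topology \<Rightarrow> 'a set rel"
  where "sm_space X = (SOME r :: 'a set rel. Well_order r \<and> (\<forall>Y. Y \<subseteq> topspace X \<longrightarrow> sm_set X Y \<le>o r) \<and>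
    (\<forall>r' :: 'a set rel. Well_order r' \<and> (\<forall>Y. Y \<subseteq> topspace X \<longrightarrow> sm_set X Y \<le>o r') \<longrightarrow> r \<le>o r'))"


lemma play_against_exists:
  assumes "Well_order r"
  shows "\<exists>U V. play_against X r s U V \<and> (\<forall>\<alpha>\<in>Field r. V \<alpha> = (if b \<alpha> then U \<alpha> else topspace X - U \<alpha>))"
proof -
  define F where "F = (\<lambda>f \<alpha>. let u = s \<alpha> (restrict f (underS r \<alpha>)) in
    (u, if b \<alpha> then u else topspace X - u))"
  define f where "f = wfrec (r - Id) F"
  have wf: "wf (r - Id)" using assms by (simp add: well_order_on_def)
  have f: "f \<alpha> = F f \<alpha>" for \<alpha>
  proof -
    have "restrict (cut f (r - Id) \<alpha>) (underS r \<alpha>) = restrict f (underS r \<alpha>)"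
      by (auto simp: restrict_def cut_def underS_def)
    then have "F (cut f (r - Id) \<alpha>) \<alpha> = F f \<alpha>" by (simp add: F_def)
    then show ?thesis using wfrec[OF wf, of F \<alpha>] by (simp add: f_def)
  qed
  have h: "history r (fst \<circ> f) (snd \<circ> f) \<alpha> = restrict f (underS r \<alpha>)" for \<alpha>
    by (simp add: history_def)
  have "(fst \<circ> f) \<alpha> = s \<alpha> (restrict f (underS r \<alpha>))" for \<alpha>
    by (simp add: f[of \<alpha>] F_def Let_def)
  moreover have "(snd \<circ> f) \<alpha> = (if b \<alpha> then (fst \<circ> f) \<alpha> else topspace X - (fst \<circ> f) \<alpha>)" for \<alpha>
    by (simp add: f[of \<alpha>] F_def Let_def)
  ultimately show ?thesis
    unfolding play_against_def h[symmetric] by (intro exI[of _ "fst \<circ> f"] exI[of _ "snd \<circ> f"]) auto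
qed

lemma seeker_wins_ordIso:
  fixes r :: "'i rel" and r' :: "'j rel"
  assumes "r =o r'" and "seeker_wins X Y r"
  shows "seeker_wins X Y r'"
proof -
  obtain f where wo: "Well_order r" and f: "iso r r' f"
    using assms(1) unfolding ordIso_def by auto
  obtain s where s: "winning_strategy X Y r s" using assms(2) unfolding seeker_wins_def by blast
  have bij: "bij_betw f (Field r) (Field r')" using f by (simp add: iso_def)
  define g where "g = the_inv_into (Field r) f"
  have gf: "g (f a) = a" if "a \<in> Field r" for a
    using that bij by (simp add: g_def bij_betw_def the_inv_into_f_f)
  have us: "bij_betw f (underS r a) (underS r' (f a))" if "a \<in> Field r" for a
    using embed_underS[OF wo, of r' f a] that f by (simp add: iso_def)
  have Fr': "Field r' = f ` Field r" using bij by (simp add: bij_betw_def)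
  define s' where "s' = (\<lambda>b h. s (g b) (restrict (h \<circ> f) (underS r (g b))))"
  have "legal_strategy X r' s'"
    using s by (auto simp: winning_strategy_def legal_strategy_def s'_def Fr' gf)
  moreover have "outcome X r' V \<subseteq> Y \<or> outcome X r' V \<inter> Y = {}" if p: "play_against X r' s' U V" for U V
  proof -
    have "history r (U \<circ> f) (V \<circ> f) a = restrict (history r' U V (f a) \<circ> f) (underS r a)"
      if "a \<in> Field r" for a
      using us[OF that] by (auto simp: history_def fun_eq_iff bij_betw_def)
    then have "play_against X r s (U \<circ> f) (V \<circ> f)"
      using p by (auto simp: play_against_def s'_def Fr' gf)
    moreover have "outcome X r (V \<circ> f) = outcome X r' V"
      by (simp add: outcome_def Fr')
    ultimately show ?thesis using s unfolding winning_strategy_def by metis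
  qed
  ultimately show ?thesis unfolding seeker_wins_def winning_strategy_def by blast
qed

lemma seeker_wins_openin:
  assumes "t0_space X"
  shows "seeker_wins X Y |Collect (openin X)|"
proof -
  let ?s = "\<lambda>(\<alpha> :: 'a set) (h :: 'a set \<Rightarrow> 'a set \<times> 'a set). \<alpha>"
  have "outcome X |Collect (openin X)| V \<subseteq> Y \<or> outcome X |Collect (openin X)| V \<inter> Y = {}"
    if p: "play_against X |Collect (openin X)| ?s U V" for U V
  proof -
    have V: "V W = W \<or> V W = topspace X - W" if "openin X W" for W
      using p that by (auto simp: play_against_def Field_card_of)
    have "x = y" if xy: "x \<in> outcome X |Collect (openin X)| V" "y \<in> outcome X |Collect (openin X)| V" for x y
    proof (rule ccontr)
      assume "x \<noteq> y"
      then obtain W where W: "openin X W" "x \<notin> W \<longleftrightarrow> y \<in> W"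
        using assms \<open>x \<noteq> y\<close> xy unfolding t0_space_def outcome_def by (meson IntD1)
      have "V W \<subseteq> W \<or> V W \<inter> W = {}" using V[OF W(1)] by blast
      moreover have "outcome X |Collect (openin X)| V \<subseteq> V W"
        using W(1) by (auto simp: outcome_def Field_card_of)
      ultimately show False using W(2) xy by blast
    qed
    then show ?thesis by blast
  qed
  then have "winning_strategy X Y |Collect (openin X)| ?s"
    unfolding winning_strategy_def by (simp add: legal_strategy_def Field_card_of)
  then show ?thesis unfolding seeker_wins_def by blast
qed

lemma sm_set_spec:
  fixes X :: "'a topology"
  assumes "t0_space X"
  shows "Well_order (sm_set X Y) \<and> seeker_wins X Y (sm_set X Y) \<and>
    (\<forall>r' :: 'a set rel. Well_order r' \<and> seeker_wins X Y r' \<longrightarrow> sm_set X Y \<le>o r')"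
proof -
  have "\<exists>r \<in> {r :: 'a set rel. Well_order r \<and> seeker_wins X Y r}.
      \<forall>r' \<in> {r :: 'a set rel. Well_order r \<and> seeker_wins X Y r}. r \<le>o r'"
    using seeker_wins_openin[OF assms, of Y] card_of_Well_order[of "Collect (openin X)"]
    by (intro exists_minim_Well_order) blast+
  then show ?thesis
    unfolding sm_set_def by (intro someI_ex[where P = "\<lambda>r. Well_order r \<and> seeker_wins X Y r \<and>
      (\<forall>r' :: 'a set rel. Well_order r' \<and> seeker_wins X Y r' \<longrightarrow> r \<le>o r')"]) blast
qed

lemma sm_set_properties:
  assumes "t0_space X"
  shows "Well_order (sm_set X Y)" and "seeker_wins X Y (sm_set X Y)"
  using sm_set_spec[OF assms] by auto

lemma sm_set_least:
  fixes X :: "'a topology" and r :: "'i rel"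
  assumes "t0_space X" and "Well_order r" and "seeker_wins X Y r"
  shows "sm_set X Y \<le>o r"
proof (rule ccontr)
  assume "\<not> sm_set X Y \<le>o r"
  then have "r <o sm_set X Y"
    using assms(2) sm_set_properties[OF assms(1), of Y] by (simp add: not_ordLeq_iff_ordLess)
  then obtain a where a: "r =o Restr (sm_set X Y) (underS (sm_set X Y) a)"
    using assms(2) sm_set_properties[OF assms(1), of Y] ordLess_iff_ordIso_Restr by blast
  have "seeker_wins X Y (Restr (sm_set X Y) (underS (sm_set X Y) a))"
    using seeker_wins_ordIso[OF a assms(3)] .
  moreover have "Well_order (Restr (sm_set X Y) (underS (sm_set X Y) a))"
    using a unfolding ordIso_def by auto
  ultimately have "sm_set X Y \<le>o Restr (sm_set X Y) (underS (sm_set X Y) a)"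
    using sm_set_spec[OF assms(1)] by blast
  then have "sm_set X Y \<le>o r" using a ordIso_symmetric ordLeq_ordIso_trans by blast
  then show False using \<open>\<not> sm_set X Y \<le>o r\<close> by blast
qed

lemma sm_space_spec:
  fixes X :: "'a topology"
  assumes "t0_space X"
  shows "Well_order (sm_space X) \<and> (\<forall>Y. Y \<subseteq> topspace X \<longrightarrow> sm_set X Y \<le>o sm_space X) \<and>
    (\<forall>r' :: 'a set rel. Well_order r' \<and> (\<forall>Y. Y \<subseteq> topspace X \<longrightarrow> sm_set X Y \<le>o r') \<longrightarrow> sm_space X \<le>o r')"
proof -
  let ?R = "{r :: 'a set rel. Well_order r \<and> (\<forall>Y. Y \<subseteq> topspace X \<longrightarrow> sm_set X Y \<le>o r)}"
  have "|Collect (openin X)| \<in> ?R"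
    using sm_set_least[OF assms card_of_Well_order seeker_wins_openin[OF assms]] card_of_Well_order
    by blast
  then have "\<exists>r \<in> ?R. \<forall>r' \<in> ?R. r \<le>o r'"
    by (intro exists_minim_Well_order) blast+
  then show ?thesis
    unfolding sm_space_def by (intro someI_ex[where P = "\<lambda>r. Well_order r \<and>
      (\<forall>Y. Y \<subseteq> topspace X \<longrightarrow> sm_set X Y \<le>o r) \<and>
      (\<forall>r' :: 'a set rel. Well_order r' \<and> (\<forall>Y. Y \<subseteq> topspace X \<longrightarrow> sm_set X Y \<le>o r') \<longrightarrow> r \<le>o r')"]) blast
qed

lemma sm_space_properties:
  assumes "t0_space X"
  shows "Well_order (sm_space X)" and "Y \<subseteq> topspace X \<Longrightarrow> sm_set X Y \<le>o sm_space X"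
  using sm_space_spec[OF assms] by auto

lemma sm_space_least:
  fixes X :: "'a topology" and r :: "'i rel"
  assumes "t0_space X" and "Well_order r" and "\<And>Y. Y \<subseteq> topspace X \<Longrightarrow> sm_set X Y \<le>o r"
  shows "sm_space X \<le>o r"
proof (rule ccontr)
  assume n: "\<not> sm_space X \<le>o r"
  then have "r <o sm_space X"
    using assms(2) sm_space_properties(1)[OF assms(1)] by (simp add: not_ordLeq_iff_ordLess)
  then obtain a where a: "r =o Restr (sm_space X) (underS (sm_space X) a)"
    using assms(2) sm_space_properties(1)[OF assms(1)] ordLess_iff_ordIso_Restr by blast
  have "sm_set X Y \<le>o Restr (sm_space X) (underS (sm_space X) a)" if "Y \<subseteq> topspace X" for Y
    using assms(3)[OF that] a ordLeq_ordIso_trans by blast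
  moreover have "Well_order (Restr (sm_space X) (underS (sm_space X) a))"
    using a unfolding ordIso_def by auto
  ultimately have "sm_space X \<le>o Restr (sm_space X) (underS (sm_space X) a)"
    using sm_space_spec[OF assms(1)] by blast
  then have "sm_space X \<le>o r" using a ordIso_symmetric ordLeq_ordIso_trans by blast
  then show False using n by blast
qed

end

theory Submission
  imports Defs
begin

text \<open>
  A winning strategy unfolds into a binary decision tree of height \<open>sm(X)\<close>, whose \<open>2^sm(X)\<close>
  branches cut \<open>X\<close> into cells that are each contained in \<open>Y\<close> or disjoint from it. If \<open>X\<close> is
  infinite, then so is \<open>o(X)\<close>, and \<open>Y\<close> can be read off the open sets in its tree and one
  bit per branch, so counting trees bounds the number of subsets \<open>Y\<close>.

  For finite \<open>X\<close> this count is too crude. Instead, let \<open>h\<close> be the height of the specialization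
  order. Each cell is convex in this order, so on a maximal chain the tree for the set of points of
  even rank needs at least \<open>h\<close> cells; hence \<open>h \<le> 2^sm(X)\<close>. Points of equal rank form an
  antichain, and a subset of an antichain is determined by the open set it generates, so \<open>Y\<close> is
  encoded by \<open>h\<close> open sets.
\<close>

section \<open>Decision trees from winning strategies\<close>

text \<open>Well-founded recursion along \<open>r\<close>. The answer \<open>t\<close> may depend on
  the set just played, as is needed for a Hider who always stays with a fixed point.\<close>

lemma play_with_responses_exists:
  assumes "Well_order r"
  shows "\<exists>U V. \<forall>\<alpha>. U \<alpha> = s \<alpha> (history r U V \<alpha>) \<and> V \<alpha> = t \<alpha> (U \<alpha>)"
proof -
  define F where "F = (\<lambda>f \<alpha>. let u = s \<alpha> (restrict f (underS r \<alpha>)) in (u, t \<alpha> u))"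
  define f where "f = wfrec (r - Id) F"
  have wf: "wf (r - Id)" using assms by (simp add: well_order_on_def)
  have f: "f \<alpha> = F f \<alpha>" for \<alpha>
  proof -
    have "restrict (cut f (r - Id) \<alpha>) (underS r \<alpha>) = restrict f (underS r \<alpha>)"
      by (auto simp: restrict_def cut_def underS_def)
    then have "F (cut f (r - Id) \<alpha>) \<alpha> = F f \<alpha>" by (simp add: F_def)
    then show ?thesis using wfrec[OF wf, of F \<alpha>] by (simp add: f_def)
  qed
  have h: "history r (fst \<circ> f) (snd \<circ> f) \<alpha> = restrict f (underS r \<alpha>)" for \<alpha>
    by (simp add: history_def)
  have "(fst \<circ> f) \<alpha> = s \<alpha> (restrict f (underS r \<alpha>)) \<and> (snd \<circ> f) \<alpha> = t \<alpha> ((fst \<circ> f) \<alpha>)" for \<alpha>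
    by (simp add: f[of \<alpha>] F_def Let_def)
  then show ?thesis
    unfolding h[symmetric] by blast
qed

text \<open>Induction along \<open>r\<close>: equal earlier moves give equal histories. This
  identifies a play that follows a point with the play fixed in advance for the same bits.\<close>

lemma play_determined_by_choices:
  assumes "Well_order r"
    and "play_against X r s U V" "play_against X r s U' V'"
    and V: "\<And>\<alpha>. \<alpha> \<in> Field r \<Longrightarrow> V \<alpha> = (if b \<alpha> then U \<alpha> else topspace X - U \<alpha>)"
    and V': "\<And>\<alpha>. \<alpha> \<in> Field r \<Longrightarrow> V' \<alpha> = (if b \<alpha> then U' \<alpha> else topspace X - U' \<alpha>)"
    and "\<alpha> \<in> Field r"
  shows "U \<alpha> = U' \<alpha>"
proof -
  have "wf (r - Id)" using assms(1) by (simp add: well_order_on_def)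
  then have "\<alpha> \<in> Field r \<longrightarrow> U \<alpha> = U' \<alpha>"
  proof (induction \<alpha> rule: wf_induct_rule)
    case (less \<alpha>)
    show ?case
    proof
      assume \<alpha>: "\<alpha> \<in> Field r"
      have "U \<gamma> = U' \<gamma> \<and> V \<gamma> = V' \<gamma>" if "\<gamma> \<in> underS r \<alpha>" for \<gamma>
      proof -
        have "(\<gamma>, \<alpha>) \<in> r - Id" "\<gamma> \<in> Field r" using that by (auto simp: underS_def Field_def)
        then show ?thesis using less V[of \<gamma>] V'[of \<gamma>] by simp
      qed
      then have "history r U V \<alpha> = history r U' V' \<alpha>"
        by (auto simp: history_def fun_eq_iff)
      then show "U \<alpha> = U' \<alpha>"
        using assms(2,3) \<alpha> by (simp add: play_against_def)
    qed
  qed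
  with assms(6) show ?thesis by blast
qed

text \<open>\<open>U b \<alpha>\<close> is the Seeker's set at move \<open>\<alpha>\<close> when the Hider keeps the set proposed at move
  \<open>\<gamma>\<close> iff \<open>b \<gamma>\<close>.\<close>

definition cell :: "'a topology \<Rightarrow> 'i rel \<Rightarrow> (('i \<Rightarrow> bool) \<Rightarrow> 'i \<Rightarrow> 'a set) \<Rightarrow> ('i \<Rightarrow> bool) \<Rightarrow> 'a set"
  where "cell X r U b = {x \<in> topspace X. \<forall>\<alpha>\<in>Field r. x \<in> U b \<alpha> \<longleftrightarrow> b \<alpha>}"

text \<open>Labels are indexed by whole branches rather than nodes; the last clause keeps what
  adaptive play contributes, namely that every point follows some branch. \<open>Func\<close> makes
  these branches exactly the functions counted by \<open>2^r\<close>.\<close>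

definition decision_tree ::
  "'a topology \<Rightarrow> 'a set \<Rightarrow> 'i rel \<Rightarrow> (('i \<Rightarrow> bool) \<Rightarrow> 'i \<Rightarrow> 'a set) \<Rightarrow> bool"
  where "decision_tree X Y r U \<longleftrightarrow>
    (\<forall>b. \<forall>\<alpha>\<in>Field r. openin X (U b \<alpha>)) \<and>
    (\<forall>b. cell X r U b \<subseteq> Y \<or> cell X r U b \<inter> Y = {}) \<and>
    (\<forall>x\<in>topspace X. \<exists>b\<in>Func (Field r) UNIV. x \<in> cell X r U b)"

text \<open>Cells are outcomes of plays, so a winning strategy makes them decide \<open>Y\<close>.
  They cover the space because the Hider can always keep the side containing a given point.\<close>

lemma decision_tree_exists:
  assumes r: "Well_order r" and "seeker_wins X Y r"
  shows "\<exists>U. decision_tree X Y r U"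
proof -
  obtain s where s: "winning_strategy X Y r s" using assms(2) unfolding seeker_wins_def by blast
  let ?ch = "\<lambda>b U V. \<forall>\<alpha>\<in>Field r. V \<alpha> = (if b \<alpha> then U \<alpha> else topspace X - U \<alpha>)"
  have "\<forall>b. \<exists>U V. play_against X r s U V \<and> ?ch b U V"
    using play_against_exists[OF r] by blast
  then obtain U V where play: "\<And>b. play_against X r s (U b) (V b)" and V: "\<And>b. ?ch b (U b) (V b)"
    by metis
  have op: "openin X (U b \<alpha>)" if "\<alpha> \<in> Field r" for b \<alpha>
    using s play[of b] that by (simp add: winning_strategy_def legal_strategy_def play_against_def)
  have "cell X r U b = outcome X r (V b)" for b
  proof -
    have "x \<in> U b \<alpha> \<longleftrightarrow> b \<alpha>" if "x \<in> V b \<alpha>" "\<alpha> \<in> Field r" for x \<alpha>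
      using V[of b] that by (cases "b \<alpha>") auto
    moreover have "x \<in> V b \<alpha>" if "x \<in> topspace X" "x \<in> U b \<alpha> \<longleftrightarrow> b \<alpha>" "\<alpha> \<in> Field r" for x \<alpha>
      using V[of b] that by (cases "b \<alpha>") auto
    ultimately show ?thesis unfolding cell_def outcome_def by blast
  qed
  moreover have "\<exists>b\<in>Func (Field r) UNIV. x \<in> cell X r U b" if x: "x \<in> topspace X" for x
  proof -
    obtain U' V' where *: "\<And>\<alpha>. U' \<alpha> = s \<alpha> (history r U' V' \<alpha>)"
      "\<And>\<alpha>. V' \<alpha> = (if x \<in> U' \<alpha> then U' \<alpha> else topspace X - U' \<alpha>)"
      using play_with_responses_exists[OF r, of s "\<lambda>\<alpha> u. if x \<in> u then u else topspace X - u"] by blast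
    \<comment> \<open>The value \<open>undefined\<close> off the field puts \<open>b\<close> into
      \<open>Func\<close>.\<close>
    define b where "b = (\<lambda>\<alpha>. if \<alpha> \<in> Field r then x \<in> U' \<alpha> else undefined)"
    have p': "play_against X r s U' V'"
      unfolding play_against_def using * by (metis insertCI)
    have "U b \<alpha> = U' \<alpha>" if "\<alpha> \<in> Field r" for \<alpha>
      by (rule play_determined_by_choices[OF r play[of b] p', of b])
        (use V *(2) that in \<open>auto simp: b_def\<close>)
    then have "x \<in> cell X r U b" using x by (simp add: cell_def b_def)
    moreover have "b \<in> Func (Field r) UNIV" by (simp add: Func_def b_def)
    ultimately show ?thesis by blast
  qed
  ultimately show ?thesis
    using s play op unfolding winning_strategy_def decision_tree_def by metis
qed

text \<open>The shorter game is simulated on the image of the embedding, with the open set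
  \<open>{}\<close> played at all other moves. Extra moves only shrink the outcome, and the winning
  condition passes to subsets.\<close>

lemma seeker_wins_mono:
  fixes r :: "'i rel" and r' :: "'j rel"
  assumes "r \<le>o r'" and "seeker_wins X Y r"
  shows "seeker_wins X Y r'"
proof -
  obtain f where wo: "Well_order r" "Well_order r'" and f: "embed r r' f"
    using assms(1) unfolding ordLeq_def by auto
  obtain s where s: "winning_strategy X Y r s" using assms(2) unfolding seeker_wins_def by blast
  have inj: "inj_on f (Field r)" using embed_inj_on[OF wo(1) f] .
  define g where "g = the_inv_into (Field r) f"
  have gf: "g (f a) = a" if "a \<in> Field r" for a
    using that inj by (simp add: g_def the_inv_into_f_f)
  have us: "bij_betw f (underS r a) (underS r' (f a))" if "a \<in> Field r" for a
    using embed_underS[OF wo(1) f that] .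
  have Fr': "f ` Field r \<subseteq> Field r'" using embed_Field[OF f] .
  define s' where "s' = (\<lambda>b h. if b \<in> f ` Field r
    then s (g b) (restrict (h \<circ> f) (underS r (g b))) else {})"
  have "legal_strategy X r' s'"
    using s by (auto simp: winning_strategy_def legal_strategy_def s'_def gf)
  moreover have "outcome X r' V \<subseteq> Y \<or> outcome X r' V \<inter> Y = {}" if p: "play_against X r' s' U V" for U V
  proof -
    have "history r (U \<circ> f) (V \<circ> f) a = restrict (history r' U V (f a) \<circ> f) (underS r a)"
      if "a \<in> Field r" for a
      using us[OF that] by (auto simp: history_def fun_eq_iff bij_betw_def)
    moreover have "U (f a) = s' (f a) (history r' U V (f a)) \<and> V (f a) \<in> {U (f a), topspace X - U (f a)}"
      if "a \<in> Field r" for a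
      using p Fr' that unfolding play_against_def by blast
    ultimately have "play_against X r s (U \<circ> f) (V \<circ> f)"
      by (auto simp: play_against_def s'_def gf)
    moreover have "outcome X r' V \<subseteq> outcome X r (V \<circ> f)"
      using Fr' by (auto simp: outcome_def)
    ultimately show ?thesis using s unfolding winning_strategy_def by blast
  qed
  ultimately show ?thesis unfolding seeker_wins_def winning_strategy_def by blast
qed

section \<open>Ranks in finite strict orders\<close>

text \<open>\<open>rk y\<close> is the supremum of \<open>Suc (rk x)\<close> over \<open>x\<close>
  below \<open>y\<close>, which is 0 for minimal points. By finiteness a nonempty supremum is
  attained, so no rank is skipped.\<close>

lemma rank_function_exists:
  fixes lt :: "'a \<Rightarrow> 'a \<Rightarrow> bool"
  assumes "finite S" and irr: "\<And>x. \<not> lt x x" and tr: "\<And>x y z. lt x y \<Longrightarrow> lt y z \<Longrightarrow> lt x z"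
  shows "\<exists>rk :: 'a \<Rightarrow> nat. (\<forall>x\<in>S. \<forall>y\<in>S. lt x y \<longrightarrow> rk x < rk y) \<and>
    (\<forall>y\<in>S. \<forall>k. rk y = Suc k \<longrightarrow> (\<exists>x\<in>S. lt x y \<and> rk x = k))"
proof -
  define R where "R = {(x, y). x \<in> S \<and> y \<in> S \<and> lt x y}"
  have "trans R" using tr by (auto simp: R_def trans_def)
  then have "acyclic R" using irr by (auto simp: acyclic_def trancl_id R_def)
  moreover have "finite R"
    by (rule finite_subset[of _ "S \<times> S"]) (use assms(1) in \<open>auto simp: R_def\<close>)
  ultimately have wf: "wf R" by (simp add: finite_acyclic_wf)
  define F where "F = (\<lambda>(f :: 'a \<Rightarrow> nat) y. Sup ((\<lambda>x. Suc (f x)) ` {x. (x, y) \<in> R}))"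
  define rk where "rk = wfrec R F"
  have rk: "rk y = Sup ((\<lambda>x. Suc (rk x)) ` {x. (x, y) \<in> R})" for y
  proof -
    have "F (cut rk R y) y = F rk y"
      by (auto simp: F_def cut_def intro!: arg_cong[where f = Sup])
    then show ?thesis using wfrec[OF wf, of F y] by (simp add: rk_def[symmetric]) (simp add: F_def)
  qed
  have fin: "finite ((\<lambda>x. Suc (rk x)) ` {x. (x, y) \<in> R})" for y
    using assms(1) by (auto simp: R_def)
  have "rk x < rk y" if "x \<in> S" "y \<in> S" "lt x y" for x y
  proof -
    have "Suc (rk x) \<le> Sup ((\<lambda>x. Suc (rk x)) ` {x. (x, y) \<in> R})"
      using that fin[of y] by (intro cSup_upper) (auto simp: R_def)
    then show ?thesis using rk[of y] by simp
  qed
  moreover have "\<exists>x\<in>S. lt x y \<and> rk x = k" if y: "rk y = Suc k" for y k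
  proof -
    let ?A = "(\<lambda>x. Suc (rk x)) ` {x. (x, y) \<in> R}"
    have "?A \<noteq> {}"
    proof
      assume "?A = {}"
      then have "rk y = 0" using rk[of y] by (simp add: Sup_nat_def)
      then show False using y by simp
    qed
    then have "Sup ?A \<in> ?A" using fin[of y] by (simp only: Sup_nat_def if_False) (rule Max_in)
    then have "Suc k \<in> ?A" using y rk[of y] by simp
    then show ?thesis by (auto simp: R_def)
  qed
  ultimately show ?thesis by blast
qed

text \<open>Descending from \<open>y\<close> one rank at a time gives a chain through every rank up
  to \<open>n\<close>.\<close>

lemma rank_chain_exists:
  fixes rk :: "'a \<Rightarrow> nat"
  assumes step: "\<And>y k. y \<in> S \<Longrightarrow> rk y = Suc k \<Longrightarrow> \<exists>x\<in>S. lt x y \<and> rk x = k"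
    and "y \<in> S" "rk y = n"
  shows "\<exists>c. (\<forall>i\<le>n. c i \<in> S \<and> rk (c i) = i) \<and> (\<forall>i<n. lt (c i) (c (Suc i))) \<and> c n = y"
  using assms(2,3)
proof (induction n arbitrary: y)
  case 0
  then show ?case by (intro exI[of _ "\<lambda>_. y"]) auto
next
  case (Suc n)
  then obtain x where x: "x \<in> S" "lt x y" "rk x = n" using step by blast
  then obtain c where c: "\<forall>i\<le>n. c i \<in> S \<and> rk (c i) = i" "\<forall>i<n. lt (c i) (c (Suc i))" "c n = x"
    using Suc.IH by blast
  show ?case
    using c x Suc.prems
    by (intro exI[of _ "c(Suc n := y)"]) (auto simp: le_Suc_eq less_Suc_eq)
qed


section \<open>Infinite spaces: counting trees\<close>

text \<open>Splitting off the value at one argument injects into \<open>B \<times> Func A B\<close>,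
  and the infinite \<open>B\<close> absorbs the product.\<close>

lemma card_of_Func_finite_infinite:
  assumes "finite A" and "infinite B"
  shows "|Func A B| \<le>o |B|"
  using assms(1)
proof (induction A rule: finite_induct)
  case empty
  have "B \<noteq> {}" using assms(2) by auto
  then show ?case by (simp add: Func_empty card_of_singl_ordLeq)
next
  case (insert a A)
  let ?g = "\<lambda>f. (f a, \<lambda>x. if x \<in> A then f x else undefined)"
  have "inj_on ?g (Func (insert a A) B)"
  proof (rule inj_onI)
    fix f h
    assume f: "f \<in> Func (insert a A) B" "h \<in> Func (insert a A) B" and eq: "?g f = ?g h"
    have "f x = h x" for x
    proof -
      consider "x = a" | "x \<in> A" | "x \<notin> insert a A" by blast
      then show ?thesis
        using f eq by cases (auto simp: Func_def dest: fun_cong[of _ _ x])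
    qed
    then show "f = h" by blast
  qed
  moreover have "?g ` Func (insert a A) B \<subseteq> B \<times> Func A B"
    by (auto simp: Func_def)
  ultimately have "|Func (insert a A) B| \<le>o |B \<times> Func A B|"
    using card_of_ordLeq by blast
  also have "|B \<times> Func A B| \<le>o |B|"
    using assms(2) insert.IH by (intro card_of_Times_ordLeq_infinite_Field)
      (simp_all add: Field_card_of card_of_card_order_on card_of_mono1)
  finally show ?case .
qed

lemma card_of_Pow_le_decision_trees:
  fixes X :: "'a topology" and r :: "'i rel"
  assumes ne: "topspace X \<noteq> {}" and tree: "\<And>Y. Y \<subseteq> topspace X \<Longrightarrow> \<exists>U. decision_tree X Y r U"
  shows "|Pow (topspace X)| \<le>o
    |Func (Func (Field r) (UNIV :: bool set) \<times> (Field r <+> {()})) (Collect (openin X))|"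
    (is "_ \<le>o |Func ?P _|")
proof -
  obtain U where U: "\<And>Y. Y \<subseteq> topspace X \<Longrightarrow> decision_tree X Y r (U Y)"
    using tree by metis
  \<comment> \<open>\<open>Inl\<close> entries record the Seeker's sets along a branch. The
    \<open>Inr\<close> entry is the bit of the branch, coded by the whole space or
    \<open>{}\<close>, which differ because the space is nonempty.\<close>
  define enc where "enc = (\<lambda>Y p. if p \<in> ?P then
      (case p of (b, Inl \<alpha>) \<Rightarrow> U Y b \<alpha>
        | (b, Inr _) \<Rightarrow> if cell X r (U Y) b \<subseteq> Y then topspace X else {}) else undefined)"
  have "enc Y \<in> Func ?P (Collect (openin X))" if "Y \<subseteq> topspace X" for Y
    using U[OF that] by (auto simp: Func_def enc_def decision_tree_def)
  then have im: "enc ` Pow (topspace X) \<subseteq> Func ?P (Collect (openin X))"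
    by blast
  have sub: "Y \<subseteq> Z" if Y: "Y \<subseteq> topspace X" and Z: "Z \<subseteq> topspace X" and eq: "enc Y = enc Z" for Y Z
  proof
    fix x
    assume x: "x \<in> Y"
    then obtain b where b: "b \<in> Func (Field r) UNIV" "x \<in> cell X r (U Y) b"
      using U[OF Y] Y unfolding decision_tree_def by blast
    \<comment> \<open>Equal codes give equal labels along \<open>b\<close>, hence the same cell; the
      bit of \<open>b\<close> then places this cell inside \<open>Z\<close>.\<close>
    have "U Y b \<alpha> = U Z b \<alpha>" if "\<alpha> \<in> Field r" for \<alpha>
      using fun_cong[OF eq, of "(b, Inl \<alpha>)"] b that by (simp add: enc_def InlI)
    then have cell: "cell X r (U Y) b = cell X r (U Z) b"
      by (simp add: cell_def)
    have "cell X r (U Y) b \<subseteq> Y"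
      using U[OF Y] b x unfolding decision_tree_def by blast
    then have "cell X r (U Z) b \<subseteq> Z"
      using fun_cong[OF eq, of "(b, Inr ())"] b ne by (simp add: enc_def InrI split: if_splits)
    then show "x \<in> Z" using b cell by blast
  qed
  have "inj_on enc (Pow (topspace X))"
    by (rule inj_onI) (use sub in \<open>simp add: subset_antisym\<close>)
  with im show ?thesis using card_of_ordLeq by blast
qed

text \<open>In a T0 space a point is determined by its family of open neighbourhoods, a set of open
  sets.\<close>

lemma infinite_openin_of_infinite_t0_space:
  assumes "t0_space X" and "infinite (topspace X)"
  shows "infinite (Collect (openin X))"
proof
  assume fin: "finite (Collect (openin X))"
  have "inj_on (\<lambda>x. {U. openin X U \<and> x \<in> U}) (topspace X)"
    using assms(1) unfolding t0_space_def inj_on_def by blast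
  moreover have "(\<lambda>x. {U. openin X U \<and> x \<in> U}) ` topspace X \<subseteq> Pow (Collect (openin X))"
    by blast
  ultimately show False
    using assms(2) fin by (meson finite_Pow_iff inj_on_finite)
qed

text \<open>The extra factor \<open>Field r <+> {()}\<close> in the exponent is absorbed: by the
  infinite number of open sets if \<open>Field r\<close> is finite, and by the infinite set of
  branches otherwise.\<close>

lemma card_of_Pow_le_infinite:
  fixes X :: "'a topology" and r :: "'i rel"
  assumes "t0_space X" and "infinite (topspace X)"
    and tree: "\<And>Y. Y \<subseteq> topspace X \<Longrightarrow> \<exists>U. decision_tree X Y r U"
  shows "|Pow (topspace X)| \<le>o |Func (Func (Field r) (UNIV :: bool set)) (Collect (openin X))|"
proof -
  let ?F = "Func (Field r) (UNIV :: bool set)" and ?O = "Collect (openin X)"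
  let ?P = "?F \<times> (Field r <+> {()})"
  have inf: "infinite ?O" using infinite_openin_of_infinite_t0_space assms(1,2) by blast
  have F: "?F \<noteq> {}" by (auto simp: Func_is_emp)
  have "|Pow (topspace X)| \<le>o |Func ?P ?O|"
    using assms(2) tree by (intro card_of_Pow_le_decision_trees) auto
  also have "|Func ?P ?O| \<le>o |Func ?F ?O|"
  proof (cases "finite (Field r)")
    case True
    have "finite (Pow (Field r))" using True by simp
    then have "finite ?F"
      using card_of_Pow_Func[of "Field r"] card_of_ordIso_finite by blast
    then have "finite ?P" using True by simp
    then have "|Func ?P ?O| \<le>o |?O|" using inf by (rule card_of_Func_finite_infinite)
    also have "|?O| \<le>o |?O| ^c |?F|"
      using F by (intro ordLeq_cexp1) (simp_all add: Field_card_of card_of_ordIso_czero_iff_empty card_of_card_order_on)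
    finally show ?thesis by (simp add: cexp_def Field_card_of)
  next
    case False
    have "|Field r| \<le>o |?F|"
      using ordLess_ordIso_trans[OF card_of_Pow card_of_Pow_Func] ordLess_imp_ordLeq by blast
    moreover from this have infF: "infinite ?F" using False card_of_ordLeq_infinite by blast
    moreover have "|{()}| \<le>o |?F|" using F by (rule card_of_singl_ordLeq)
    ultimately have "|?P| \<le>o |?F|"
      by (intro card_of_Times_ordLeq_infinite_Field card_of_Plus_ordLeq_infinite_Field)
        (simp_all add: Field_card_of card_of_card_order_on card_of_mono1)
    then have "|?O| ^c |?P| \<le>o |?O| ^c |?F|"
      using F by (intro cexp_mono2') (simp_all add: Field_card_of card_of_card_order_on card_of_mono1)
    then show ?thesis by (simp add: cexp_def Field_card_of)
  qed
  finally show ?thesis .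
qed

section \<open>Finite spaces: ranks in the specialization order\<close>

text \<open>Only one tree is used, that of the points of even rank; it injects the ranks into the
  branches. An arbitrary \<open>Y\<close> is then encoded by unions of least open
  neighbourhoods.\<close>

lemma card_of_Pow_le_finite:
  fixes X :: "'a topology" and r :: "'i rel"
  assumes t0: "t0_space X" and fin: "finite (topspace X)"
    and tree: "\<And>Y. Y \<subseteq> topspace X \<Longrightarrow> \<exists>U. decision_tree X Y r U"
  shows "|Pow (topspace X)| \<le>o |Func (Func (Field r) (UNIV :: bool set)) (Collect (openin X))|"
proof -
  \<comment> \<open>\<open>nb x\<close> is the least open neighbourhood of \<open>x\<close>, its up-set in the specialization order.\<close>
  define nb where "nb = (\<lambda>x. \<Inter>{U. openin X U \<and> x \<in> U})"
  define lt where "lt = (\<lambda>x y. y \<in> nb x \<and> x \<notin> nb y)"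
  have finO: "finite (Collect (openin X))"
    by (rule finite_subset[of _ "Pow (topspace X)"]) (use fin openin_subset in auto)
  have nb_open: "openin X (nb x)" if "x \<in> topspace X" for x
  proof -
    have "finite {U. openin X U \<and> x \<in> U}" by (rule finite_subset[OF _ finO]) blast
    moreover have "{U. openin X U \<and> x \<in> U} \<noteq> {}" using that openin_topspace by blast
    ultimately show ?thesis unfolding nb_def by (intro openin_Inter) auto
  qed
  have nb_self: "x \<in> nb x" for x by (simp add: nb_def)
  \<comment> \<open>The T0 axiom is antisymmetry of the specialization order.\<close>
  have nb_lt: "lt x y" if xy: "x \<in> topspace X" "y \<in> topspace X" "y \<in> nb x" "x \<noteq> y" for x y
  proof -
    obtain W where "openin X W" "x \<notin> W \<longleftrightarrow> y \<in> W"
      using t0 xy unfolding t0_space_def by metis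
    then show ?thesis using xy(3) unfolding lt_def nb_def by blast
  qed
  have lt_irrefl: "\<not> lt x x" for x by (simp add: lt_def)
  have nb_mono: "nb y \<subseteq> nb x" if "y \<in> nb x" for x y
    using that by (auto simp: nb_def)
  have lt_trans: "lt x z" if "lt x y" "lt y z" for x y z
    using that nb_mono[of y x] nb_mono[of x z] by (auto simp: lt_def)
  obtain rk :: "'a \<Rightarrow> nat"
    where rk: "\<And>x y. x \<in> topspace X \<Longrightarrow> y \<in> topspace X \<Longrightarrow> lt x y \<Longrightarrow> rk x < rk y"
      and step: "\<And>y k. y \<in> topspace X \<Longrightarrow> rk y = Suc k \<Longrightarrow> \<exists>x\<in>topspace X. lt x y \<and> rk x = k"
  proof -
    have "\<exists>rk :: 'a \<Rightarrow> nat. (\<forall>x\<in>topspace X. \<forall>y\<in>topspace X. lt x y \<longrightarrow> rk x < rk y) \<and>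
        (\<forall>y\<in>topspace X. \<forall>k. rk y = Suc k \<longrightarrow> (\<exists>x\<in>topspace X. lt x y \<and> rk x = k))"
      by (rule rank_function_exists) (fact fin lt_irrefl lt_trans)+
    then show ?thesis using that by blast
  qed
  let ?F = "Func (Field r) (UNIV :: bool set)"
  have "\<exists>e :: nat \<Rightarrow> 'i \<Rightarrow> bool. inj_on e (rk ` topspace X) \<and> e ` rk ` topspace X \<subseteq> ?F"
  proof (cases "topspace X = {}")
    case False
    define n where "n = Max (rk ` topspace X)"
    have "n \<in> rk ` topspace X" unfolding n_def using False fin by (intro Max_in) auto
    then obtain y where "y \<in> topspace X" "rk y = n" by blast
    then obtain c where c: "\<And>i. i \<le> n \<Longrightarrow> c i \<in> topspace X" "\<And>i. i \<le> n \<Longrightarrow> rk (c i) = i"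
        and lt: "\<And>i. i < n \<Longrightarrow> lt (c i) (c (Suc i))"
      using rank_chain_exists[of "topspace X" rk lt y n, OF step] by blast
    \<comment> \<open>Parity of the rank separates consecutive points of the chain.\<close>
    define E where "E = {x \<in> topspace X. even (rk x)}"
    obtain U where U: "decision_tree X E r U" using tree[of E] by (auto simp: E_def)
    then have "\<forall>i. \<exists>b. i \<le> n \<longrightarrow> b \<in> ?F \<and> c i \<in> cell X r U b"
      using c(1) unfolding decision_tree_def by blast
    then obtain e where e: "\<And>i. i \<le> n \<Longrightarrow> e i \<in> ?F \<and> c i \<in> cell X r U (e i)"
      by metis
    have up: "c j \<in> W" if "openin X W" "c i \<in> W" "i \<le> j" "j \<le> n" for W i j
      using that(3,4)
    proof (induction j rule: dec_induct)
      case base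
      show ?case using that by simp
    next
      case (step k)
      then have "c (Suc k) \<in> nb (c k)" "c k \<in> W" using lt[of k] by (auto simp: lt_def)
      then show ?case using that(1) by (auto simp: nb_def)
    qed
    have ne: "e i \<noteq> e j" if "i < j" "j \<le> n" for i j
    proof
      assume "e i = e j"
      then have ij: "c i \<in> cell X r U (e i)" "c j \<in> cell X r U (e i)"
        using e[of i] e[of j] that by auto
      \<comment> \<open>Convexity of cells: an open set containing \<open>c i\<close> contains
        \<open>c (Suc i)\<close>, and one containing \<open>c (Suc i)\<close> contains
        \<open>c j\<close>.\<close>
      have "c (Suc i) \<in> U (e i) \<alpha> \<longleftrightarrow> e i \<alpha>" if \<alpha>: "\<alpha> \<in> Field r" for \<alpha>
      proof -
        have op: "openin X (U (e i) \<alpha>)" using U \<alpha> unfolding decision_tree_def by blast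
        have "c i \<in> U (e i) \<alpha> \<longleftrightarrow> e i \<alpha>" "c j \<in> U (e i) \<alpha> \<longleftrightarrow> e i \<alpha>"
          using ij \<alpha> by (auto simp: cell_def)
        then show ?thesis
          using up[OF op, of i "Suc i"] up[OF op, of "Suc i" j] \<open>i < j\<close> \<open>j \<le> n\<close> by auto
      qed
      then have "c (Suc i) \<in> cell X r U (e i)" using c(1)[of "Suc i"] that by (simp add: cell_def)
      then have "c i \<in> E \<longleftrightarrow> c (Suc i) \<in> E"
        using ij(1) U unfolding decision_tree_def by blast
      then show False using c[of i] c[of "Suc i"] that by (simp add: E_def)
    qed
    have "rk ` topspace X \<subseteq> {..n}" unfolding n_def using fin by auto
    moreover have "inj_on e {..n}"
      using ne by (intro linorder_inj_onI') auto
    moreover have "e ` {..n} \<subseteq> ?F" using e by auto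
    ultimately show ?thesis by (meson inj_on_subset image_mono subset_trans)
  qed auto
  then obtain e :: "nat \<Rightarrow> 'i \<Rightarrow> bool"
    where e: "inj_on e (rk ` topspace X)" "e ` rk ` topspace X \<subseteq> ?F" by blast
  \<comment> \<open>Branch \<open>b\<close> stores the up-set generated by the points of
    \<open>Y\<close> whose rank is sent to \<open>b\<close>; a branch assigned to no rank stores
    \<open>{}\<close>.\<close>
  define enc where "enc = (\<lambda>Y b. if b \<in> ?F then \<Union>(nb ` {y \<in> Y. e (rk y) = b}) else undefined)"
  have "enc Y \<in> Func ?F (Collect (openin X))" if "Y \<subseteq> topspace X" for Y
  proof -
    have "openin X (\<Union>(nb ` {y \<in> Y. e (rk y) = b}))" for b
      using that nb_open by (intro openin_Union) blast
    then show ?thesis unfolding enc_def by (subst Func_def) simp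
  qed
  then have im: "enc ` Pow (topspace X) \<subseteq> Func ?F (Collect (openin X))"
    by blast
  have sub: "Y \<subseteq> Z" if Y: "Y \<subseteq> topspace X" and Z: "Z \<subseteq> topspace X" and eq: "enc Y = enc Z" for Y Z
  proof
    fix x
    assume x: "x \<in> Y"
    then have "e (rk x) \<in> ?F" using e(2) Y by blast
    then have enc: "enc A (e (rk x)) = \<Union>(nb ` {y \<in> A. e (rk y) = e (rk x)})" for A
      by (simp add: enc_def)
    have "x \<in> enc Y (e (rk x))" unfolding enc using x nb_self by blast
    then obtain z where z: "z \<in> Z" "e (rk z) = e (rk x)" "x \<in> nb z"
      unfolding eq enc by blast
    have X: "x \<in> topspace X" "z \<in> topspace X" using x z(1) Y Z by auto
    then have "rk z = rk x" using inj_onD[OF e(1) z(2)] by blast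
    \<comment> \<open>Otherwise \<open>z\<close> would lie strictly below \<open>x\<close> and have
      smaller rank.\<close>
    then have "z = x" using nb_lt[of z x] rk[of z x] X z(3) by fastforce
    then show "x \<in> Z" using z by simp
  qed
  have "inj_on enc (Pow (topspace X))"
    by (rule inj_onI) (use sub in \<open>simp add: subset_antisym\<close>)
  with im show ?thesis using card_of_ordLeq by blast
qed

theorem theorem2p4:
  fixes X :: "'a topology"
  assumes "t0_space X"
  shows "ctwo ^c |topspace X| \<le>o |Collect (openin X)| ^c (ctwo ^c sm_space X)"
proof -
  let ?r = "sm_space X"
  \<comment> \<open>Since \<open>sm_set X Y\<close> is at most \<open>sm_space X\<close>,
    monotonicity in the length gives all \<open>Y\<close> trees of one common height.\<close>
  have "\<exists>U. decision_tree X Y ?r U" if "Y \<subseteq> topspace X" for Y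
    using decision_tree_exists sm_space_properties[OF assms] sm_set_properties[OF assms]
      seeker_wins_mono that by metis
  then have "|Pow (topspace X)| \<le>o |Func (Func (Field ?r) (UNIV :: bool set)) (Collect (openin X))|"
    using card_of_Pow_le_infinite card_of_Pow_le_finite assms by metis
  then have "|Func (topspace X) (UNIV :: bool set)| \<le>o
      |Func (Func (Field ?r) (UNIV :: bool set)) (Collect (openin X))|"
    using card_of_Pow_Func ordIso_symmetric ordIso_ordLeq_trans by blast
  \<comment> \<open>\<open>^c\<close> depends only on the fields, so the ordinal in the exponent
    stands for the functions on its underlying set.\<close>
  then show ?thesis by (simp add: cexp_def ctwo_def Field_card_of)
qed

end
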